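(* Let $(L,\leq,0,1)$ be a bounded lattice, $e\in L\setminus\{0,1\}$, and let $S_e$ be a $t$-conorm on $[e,1]$. Let $U_{S_e}: L^2\to L$ be defined by $$ U_{S_e}(x,y)=\begin{cases} S_e(x,y), & (x,y)\in [e,1]^2,\\ y, & (x,y)\in [e,1]\times I_e,\\ x, & (x,y)\in I_e\times [e,1],\\ 0, & (x,y)\in ([0,e)\times I_e)\cup(I_e\times[0,e)),\\ x\wedge y, & (x,y)\in ([0,e)\times [e,1])\cup([e,1]\times[0,e))\cup(I_e\times I_e),\\ x\wedge y, & \text{otherwise.} \end{cases} $$ Then the following statements are equivalent: (i) $U_{S_e}$ is a uninorm on $L$ with the neutral element $e$; (ii) $\mathscr{P}:=\{x\in(0,e): \exists\, y\in I_e,\ x\leq y\}=\emptyset$; (iii) $I_e\,\|\,(0,e]$.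
   Context: $(L,\leq,0,1)$ is a lattice with bottom element $0$ and top element $1$; $\wedge,\vee$ are infimum and supremum; $x<y$ means $x\leq y$ and $x\neq y$. For $a\leq b$, $[a,b]=\{x\in L: a\leq x\leq b\}$, and $[a,b)$, $(a,b]$, $(a,b)$ are defined similarly (with strict inequality $<$ at the open end). Elements $x,y$ are incomparable, written $x\| y$, if $x\nleq y$ and $y\nleq x$; $I_e=\{x\in L: x\| e\}$. For subsets $A,B\subset L$, $A\| B$ means that $x\| y$ for all $x\in A$ and $y\in B$. A uninorm on $L$ is a binary operation $U:L^2\to L$ that is commutative, associative, increasing (i.e. order-preserving) in each variable, and has a neutral element $e\in L$, i.e. $U(e,x)=x$ for all $x\in L$. A $t$-conorm on $[e,1]$ is a commutative, associative operation $[e,1]^2\to[e,1]$, increasing in each variable, with neutral element $e$. *)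

theory Defs
  imports Main
begin

definition incomparable :: "'a::order \<Rightarrow> 'a \<Rightarrow> bool" where
  "incomparable x y \<longleftrightarrow> \<not> x \<le> y \<and> \<not> y \<le> x"

definition incomparables :: "'a::order \<Rightarrow> 'a set" where
  "incomparables e = {x. incomparable x e}"

definition sets_incomparable :: "'a::order set \<Rightarrow> 'a set \<Rightarrow> bool" where
  "sets_incomparable A B \<longleftrightarrow> (\<forall>x\<in>A. \<forall>y\<in>B. incomparable x y)"

definition neutral_element :: "('a \<Rightarrow> 'a \<Rightarrow> 'a) \<Rightarrow> 'a \<Rightarrow> bool" where
  "neutral_element U e \<longleftrightarrow> (\<forall>x. U e x = x)"

definition uninorm :: "('a::bounded_lattice \<Rightarrow> 'a \<Rightarrow> 'a) \<Rightarrow> bool" where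
  "uninorm U \<longleftrightarrow>
     (\<forall>x y. U x y = U y x) \<and>
     (\<forall>x y z. U (U x y) z = U x (U y z)) \<and>
     (\<forall>x y z. x \<le> y \<longrightarrow> U x z \<le> U y z \<and> U z x \<le> U z y) \<and>
     (\<exists>e. neutral_element U e)"

text \<open>A t-conorm on the interval from \<open>a\<close> to \<open>b\<close> is represented by a total binary function of
  which only the values on \<open>{a..b}\<close> matter; the first conjunct says that it maps
  \<open>{a..b} \<times> {a..b}\<close> into \<open>{a..b}\<close>.\<close>

definition t_conorm_on :: "'a::bounded_lattice \<Rightarrow> 'a \<Rightarrow> ('a \<Rightarrow> 'a \<Rightarrow> 'a) \<Rightarrow> bool" where
  "t_conorm_on a b S \<longleftrightarrow>
     (\<forall>x\<in>{a..b}. \<forall>y\<in>{a..b}. S x y \<in> {a..b}) \<and>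
     (\<forall>x\<in>{a..b}. \<forall>y\<in>{a..b}. S x y = S y x) \<and>
     (\<forall>x\<in>{a..b}. \<forall>y\<in>{a..b}. \<forall>z\<in>{a..b}. S (S x y) z = S x (S y z)) \<and>
     (\<forall>x\<in>{a..b}. \<forall>y\<in>{a..b}. \<forall>z\<in>{a..b}. x \<le> y \<longrightarrow> S x z \<le> S y z \<and> S z x \<le> S z y) \<and>
     (\<forall>x\<in>{a..b}. S a x = x)"

text \<open>The domains of the branches are pairwise disjoint, so their order is immaterial; the last
  branch is reached exactly on \<open>{bot..<e} \<times> {bot..<e}\<close>.\<close>

definition U_conorm :: "('a::bounded_lattice \<Rightarrow> 'a \<Rightarrow> 'a) \<Rightarrow> 'a \<Rightarrow> 'a \<Rightarrow> 'a \<Rightarrow> 'a" where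
  "U_conorm S e x y =
     (if (x, y) \<in> {e..top} \<times> {e..top} then S x y
      else if (x, y) \<in> {e..top} \<times> incomparables e then y
      else if (x, y) \<in> incomparables e \<times> {e..top} then x
      else if (x, y) \<in> {bot..<e} \<times> incomparables e \<union> incomparables e \<times> {bot..<e} then bot
      else if (x, y) \<in> {bot..<e} \<times> {e..top} \<union> {e..top} \<times> {bot..<e}
                       \<union> incomparables e \<times> incomparables e then inf x y
      else inf x y)"

end

theory Submission
  imports Defs
begin

text \<open>Monotonicity at \<open>(x, x) \<le> (y, x)\<close> for \<open>x \<in> (0,e)\<close>, \<open>y \<in> I\<^sub>e\<close>, \<open>x \<le> y\<close> would give
  \<open>x \<le> 0\<close>. Conversely, if there are no such \<open>x\<close> and \<open>y\<close>, then \<open>[0,e)\<close> and \<open>I\<^sub>e\<close> have meet \<open>0\<close>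
  elementwise, so the operation is \<open>S\<close> on the up-set of \<open>e\<close>, is the meet on the complementary
  down-set, and returns the argument outside the up-set in the mixed case. In this form the
  uninorm axioms are immediate.\<close>

lemma U_conorm_eq:
  fixes e :: "'a::bounded_lattice"
  assumes "{x \<in> {bot<..<e}. \<exists>y \<in> incomparables e. x \<le> y} = {}"
  shows "U_conorm S e x y =
    (if e \<le> x then if e \<le> y then S x y else y
     else if e \<le> y then x else inf x y)"
proof -
  \<comment> \<open>A nonzero \<open>inf u v\<close> would itself be an excluded element: it lies
    strictly between \<open>bot\<close> and \<open>e\<close> and below \<open>v\<close>.\<close>
  have bot: "inf u v = bot" if "u < e" "v \<in> incomparables e" for u v
  proof (rule ccontr)
    assume "inf u v \<noteq> bot"
    moreover have "inf u v < e"
      using that(1) by (meson inf.cobounded1 le_less_trans)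
    ultimately have "inf u v \<in> {x \<in> {bot<..<e}. \<exists>y \<in> incomparables e. x \<le> y}"
      using that(2) by (auto simp: bot.not_eq_extremum intro: bexI[of _ v])
    then show False using assms by blast
  qed
  have low: "\<not> e \<le> u \<Longrightarrow> u < e \<or> u \<in> incomparables e" for u
    by (auto simp: incomparables_def incomparable_def)
  have inc: "u \<in> incomparables e \<Longrightarrow> \<not> e \<le> u \<and> \<not> u < e" for u
    by (auto simp: incomparables_def incomparable_def)
  consider "e \<le> x" "e \<le> y" | "e \<le> x" "\<not> e \<le> y" | "\<not> e \<le> x" "e \<le> y"
    | "\<not> e \<le> x" "\<not> e \<le> y" by blast
  then show ?thesis
  proof cases
    case 1
    then show ?thesis by (simp add: U_conorm_def)
  next
    \<comment> \<open>If \<open>y < e\<close>, a meet branch applies and returns \<open>y\<close>,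
      since \<open>y < e \<le> x\<close>.\<close>
    case 2
    then show ?thesis using low[of y] inc[of x]
      by (auto simp: U_conorm_def inf_absorb2)
  next
    case 3
    then show ?thesis using low[of x] inc[of y]
      by (auto simp: U_conorm_def inf_absorb1)
  next
    \<comment> \<open>The only branch here that is not literally a meet is the constant
      \<open>bot\<close>, for one argument below \<open>e\<close> and one in
      \<open>incomparables e\<close>; there the meet is \<open>bot\<close>.\<close>
    case 4
    then show ?thesis using bot[of x y] bot[of y x]
      by (auto simp: U_conorm_def inf.commute)
  qed
qed

lemma uninorm_U_conorm:
  fixes e :: "'a::bounded_lattice"
  assumes S: "t_conorm_on e top S"
    and P: "{x \<in> {bot<..<e}. \<exists>y \<in> incomparables e. x \<le> y} = {}"
  shows "uninorm (U_conorm S e)" and "neutral_element (U_conorm S e) e"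
proof -
  note U = U_conorm_eq[OF P, of S]
  have cl: "e \<le> S x y" if "e \<le> x" "e \<le> y" for x y
    using S that by (auto simp: t_conorm_on_def)
  have comm: "S x y = S y x" if "e \<le> x" "e \<le> y" for x y
    using S that by (auto simp: t_conorm_on_def)
  have assoc: "S (S x y) z = S x (S y z)" if "e \<le> x" "e \<le> y" "e \<le> z" for x y z
    using S that by (auto simp: t_conorm_on_def)
  have mono: "S x z \<le> S y z" if "e \<le> x" "e \<le> y" "e \<le> z" "x \<le> y" for x y z
    using S that by (auto simp: t_conorm_on_def)
  have unit: "S e x = x" if "e \<le> x" for x
    using S that by (auto simp: t_conorm_on_def)
  \<comment> \<open>Raise \<open>e\<close> to \<open>y\<close> in \<open>S e x = x\<close>, then
    commute.\<close>
  have ge: "x \<le> S x y" if "e \<le> x" "e \<le> y" for x y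
    using mono[of e y x] comm[of x y] unit[of x] that comm[of e x] by (metis order_refl)
  show neutral: "neutral_element (U_conorm S e) e"
    by (auto simp: neutral_element_def U unit)
  have U_comm: "U_conorm S e x y = U_conorm S e y x" for x y
    by (auto simp: U comm inf.commute)
  \<comment> \<open>Once some argument is not above \<open>e\<close>, both sides are the meet of all
    such arguments: arguments above \<open>e\<close> act neutrally on them, \<open>S\<close> stays
    above \<open>e\<close>, and the meets stay outside.\<close>
  have U_assoc: "U_conorm S e (U_conorm S e x y) z = U_conorm S e x (U_conorm S e y z)" for x y z
    by (auto simp: U cl assoc inf.assoc)
  have U_mono: "U_conorm S e x z \<le> U_conorm S e y z" if "x \<le> y" for x y z
  proof (cases "e \<le> x")
    case True
    then show ?thesis using that mono[of x y z] by (auto simp: U)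
  next
    \<comment> \<open>\<open>ge\<close> serves the case where \<open>S\<close> enters only on the
      right: \<open>e \<le> y\<close> and \<open>e \<le> z\<close> give
      \<open>x \<le> y \<le> S y z\<close>.\<close>
    case False
    then show ?thesis using that ge[of y z] order_trans[of x y "S y z"] ge[of z y] comm[of y z]
      by (auto simp: U le_infI1)
  qed
  show "uninorm (U_conorm S e)"
    unfolding uninorm_def
    using U_comm U_assoc U_mono neutral by metis
qed

lemma uninorm_U_conorm_imp_empty:
  fixes e :: "'a::bounded_lattice"
  assumes "uninorm (U_conorm S e)"
  shows "{x \<in> {bot<..<e}. \<exists>y \<in> incomparables e. x \<le> y} = {}"
proof (rule ccontr)
  assume "\<not> ?thesis"
  then obtain x y where x: "bot < x" "x < e" and y: "y \<in> incomparables e" and "x \<le> y"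
    by auto
  then have "U_conorm S e x x \<le> U_conorm S e y x"
    using assms by (auto simp: uninorm_def)
  \<comment> \<open>\<open>(x, x)\<close> falls to the last branch, a meet, while
    \<open>(y, x)\<close> lies in the \<open>bot\<close> branch.\<close>
  moreover have "U_conorm S e x x = x"
    using x by (auto simp: U_conorm_def incomparables_def incomparable_def)
  moreover have "U_conorm S e y x = bot"
    using x y by (auto simp: U_conorm_def incomparables_def incomparable_def)
  ultimately show False using x by simp
qed

text \<open>For \<open>y\<close> in \<open>incomparables e\<close> and \<open>x \<le> e\<close>,
  \<open>y \<le> x\<close> would force \<open>y \<le> e\<close>, so only \<open>x \<le> y\<close>
  can break incomparability; the endpoint \<open>x = e\<close> never does.\<close>

lemma empty_iff_sets_incomparable:
  fixes e :: "'a::bounded_lattice"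
  shows "{x \<in> {bot<..<e}. \<exists>y \<in> incomparables e. x \<le> y} = {}
    \<longleftrightarrow> sets_incomparable (incomparables e) {bot<..e}"
proof -
  have "incomparable y x \<longleftrightarrow> \<not> x \<le> y" if "y \<in> incomparables e" "x \<le> e" for x y
    using that by (auto simp: incomparables_def incomparable_def dest: order_trans[of y x e])
  moreover have "\<not> e \<le> y" if "y \<in> incomparables e" for y
    using that by (simp add: incomparables_def incomparable_def)
  ultimately show ?thesis
    by (auto simp: sets_incomparable_def le_less[of _ e])
qed

theorem theorem12:
  fixes e :: "'a::bounded_lattice" and S :: "'a \<Rightarrow> 'a \<Rightarrow> 'a"
  assumes "e \<noteq> bot" and "e \<noteq> top"
    and "t_conorm_on e top S"
  shows "(uninorm (U_conorm S e) \<and> neutral_element (U_conorm S e) e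
            \<longleftrightarrow> {x \<in> {bot<..<e}. \<exists>y \<in> incomparables e. x \<le> y} = {})
       \<and> ({x \<in> {bot<..<e}. \<exists>y \<in> incomparables e. x \<le> y} = {}
            \<longleftrightarrow> sets_incomparable (incomparables e) {bot<..e})"
  using uninorm_U_conorm[OF assms(3)] uninorm_U_conorm_imp_empty[of S e]
    empty_iff_sets_incomparable[of e] by blast

end
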